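(* Suppose that Assumption A holds. Then every global minimizer $(X,Y,S)$ of problem (FR) satisfies the isolation property (C2), and hence (FB) and (FR) have the same set of global minimizers and the same optimal value: $\mathcal{G}_{(FB)}=\mathcal{G}_{(FR)}$ and $V_{(FB)}=V_{(FR)}$. Moreover, any global minimizer $(X,Y,S)$ of problems (FB) and (FR) has the properties (C1) and (C2).
   Context: Let $m,n,d$ be positive integers, $\lambda,\beta\ge 0$, $\tau\in[0,+\infty]$, and let $f:\mathbb{R}^{m\times n}\times\mathbb{R}^{m\times n}\to[0,+\infty)$ be locally Lipschitz continuous. $\|S\|_0$ is the number of nonzero entries of $S$; $\mathrm{nnzc}(X)$ the number of nonzero columns of $X$; $U_i$ the $i$-th column of $U$. Let $\mathcal{B}^X:=\{X\in\mathbb{R}^{m\times d}:\|X_i\|_2\le\tau\ \forall i\}$, $\mathcal{B}^Y:=\{Y\in\mathbb{R}^{n\times d}:\|Y_i\|_2\le\tau\ \forall i\}$, $\mathcal{B}^S:=\{S\in\mathbb{R}^{m\times n}:\kappa^1_{ij}\le S_{ij}\le\kappa^2_{ij}\ \forall i,j\}$ with given $\kappa^1_{ij}\in[-\infty,0]$, $\kappa^2_{ij}\in[0,+\infty]$, and $\mathcal{B}:=\mathcal{B}^X\times\mathcal{B}^Y\times\mathcal{B}^S$. Problem (FB): minimize $F(X,Y,S):=f(XY^{\mathbb{T}},S)+\lambda(\mathrm{nnzc}(X)+\mathrm{nnzc}(Y))+\beta\|S\|_0$ over $\mathcal{B}$. Relaxation: let $\theta_1:[0,+\infty)\to[0,+\infty)$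 satisfy $\theta_1(0)=0$, $\theta_1(1)=1$, $\theta_1(t)\in(0,1)$ for $t\in(0,1)$, $\theta_1(t)>1$ for $t>1$; let $\theta_2\equiv1$ and $\theta:=\min\{\theta_1,\theta_2\}$. For $\rho>0$ put $\Theta^\rho(V):=\sum_{i=1}^d\theta(\|V_i\|_2/\rho)$ for matrices $V$ with $d$ columns and $\tilde\Theta^\rho(S):=\sum_{i=1}^m\sum_{j=1}^n\theta(|S_{ij}|/\rho)$ for $S\in\mathbb{R}^{m\times n}$. For $r,s>0$, Problem (FR): minimize $F_\theta^{r,s}(X,Y,S):=f(XY^{\mathbb{T}},S)+\lambda(\Theta^r(X)+\Theta^r(Y))+\beta\tilde\Theta^s(S)$ over $\mathcal{B}$. $V_{(P)}$ and $\mathcal{G}_{(P)}$ denote the optimal value and the set of global minimizers of problem $(P)$. (C1) (consistency): $\mathbb{I}_X=\mathbb{I}_Y$, where $\mathbb{I}_U:=\{i\in[d]:U_i\ne\bm0\}$ if $\lambda>0$ and $\mathbb{I}_U:=[d]$ if $\lambda=0$. (C2) (isolation): $\|X_i\|_2,\|Y_i\|_2\notin(0,r)$ for all $i\in[d]$ if $\lambda>0$, and $|S_{ij}|\notin(0,s)$ for all $(i,j)\in[m]\times[n]$ if $\beta>0$. Assumption A: (i) For any $k\in[d]$ and $(i,j)\in[m]\times[n]$, $f(XY^{\mathbb{T}},S)$ is Lipschitz continuous on $\mathcal{B}$ with respect to $X_k$ and with respect to $Y_k$ with positive Lipschitz constants $L_X$ and $L_Y$, respectively, if $\lambda>0$,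 and with respect to $S_{ij}$ with positive Lipschitz constant $L_S$ if $\beta>0$ (the constants being uniform over the other variables in $\mathcal{B}$ and over $k,i,j$). (ii) $\theta_1$ is locally Lipschitz continuous on $[0,+\infty)$ with $\eta:=\min\{\eta_1\in\partial^c\theta_1(t):t\in(0,1)\}>0$, where $\partial^c$ is the Clarke subdifferential, and the positive parameters $r,s$ satisfy $r<\min\{\tau,\lambda\eta/\max\{L_X,L_Y\}\}$ if $\lambda>0$, and $s<\beta\eta/L_S$ if $\beta>0$. *)

theory Defs
  imports "HOL-Analysis.Analysis"
begin

definition locally_lipschitz_on ::
    "'a::metric_space set \<Rightarrow> ('a \<Rightarrow> 'b::metric_space) \<Rightarrow> bool" where
  "locally_lipschitz_on A f \<longleftrightarrow> (\<forall>x\<in>A. \<exists>u>0. \<exists>L. L-lipschitz_on (ball x u \<inter> A) f)"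

text \<open>Clarke's generalized directional derivative
  \<open>limsup (f (y + t v) - f y) / t\<close> as \<open>y \<rightarrow> x\<close> and \<open>t \<down> 0\<close>; the base point
  \<open>y\<close> is allowed to equal \<open>x\<close>, hence \<open>nhds x\<close> and not \<open>at x\<close>.\<close>

definition clarke_dd :: "('a::real_normed_vector \<Rightarrow> real) \<Rightarrow> 'a \<Rightarrow> 'a \<Rightarrow> ereal" where
  "clarke_dd f x v =
     Limsup (nhds x \<times>\<^sub>F at_right (0::real)) (\<lambda>(y, t). ereal ((f (y + t *\<^sub>R v) - f y) / t))"

definition clarke_subdiff :: "('a::real_inner \<Rightarrow> real) \<Rightarrow> 'a \<Rightarrow> 'a set" where
  "clarke_subdiff f x = {\<xi>. \<forall>v. ereal (\<xi> \<bullet> v) \<le> clarke_dd f x v}"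

definition global_minimizers :: "('a \<Rightarrow> real) \<Rightarrow> 'a set \<Rightarrow> 'a set" where
  "global_minimizers F B = {z \<in> B. \<forall>w\<in>B. F z \<le> F w}"

definition optimal_value :: "('a \<Rightarrow> real) \<Rightarrow> 'a set \<Rightarrow> ereal" where
  "optimal_value F B = (INF z\<in>B. ereal (F z))"

text \<open>An \<open>m \<times> n\<close> matrix has type \<open>real ^ 'n ^ 'm\<close>, with entries \<open>A $ i $ j\<close>; the norm of
  \<open>column j A\<close> is the Euclidean one.\<close>

type_synonym ('m, 'n, 'd) triple = "(real ^ 'd ^ 'm) \<times> (real ^ 'd ^ 'n) \<times> (real ^ 'n ^ 'm)"

definition nnzc :: "real ^ 'd ^ 'm \<Rightarrow> nat" where
  "nnzc U = card {i. column i U \<noteq> 0}"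

definition l0_norm :: "real ^ 'n ^ 'm \<Rightarrow> nat" where
  "l0_norm S = card {(i, j). S $ i $ j \<noteq> 0}"

definition col_ball :: "ereal \<Rightarrow> (real ^ 'd ^ 'm) set" where
  "col_ball \<tau> = {U. \<forall>i. ereal (norm (column i U)) \<le> \<tau>}"

definition entry_box :: "('m \<Rightarrow> 'n \<Rightarrow> ereal) \<Rightarrow> ('m \<Rightarrow> 'n \<Rightarrow> ereal) \<Rightarrow> (real ^ 'n ^ 'm) set" where
  "entry_box \<kappa>1 \<kappa>2 = {S. \<forall>i j. \<kappa>1 i j \<le> ereal (S $ i $ j) \<and> ereal (S $ i $ j) \<le> \<kappa>2 i j}"

definition feasible_set ::
    "ereal \<Rightarrow> ('m \<Rightarrow> 'n \<Rightarrow> ereal) \<Rightarrow> ('m \<Rightarrow> 'n \<Rightarrow> ereal) \<Rightarrow> ('m::finite, 'n::finite, 'd::finite) triple set" where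
  "feasible_set \<tau> \<kappa>1 \<kappa>2 = col_ball \<tau> \<times> col_ball \<tau> \<times> entry_box \<kappa>1 \<kappa>2"

definition F_obj ::
    "((real ^ 'n ^ 'm) \<times> (real ^ 'n ^ 'm) \<Rightarrow> real) \<Rightarrow> real \<Rightarrow> real
      \<Rightarrow> ('m::finite, 'n::finite, 'd::finite) triple \<Rightarrow> real" where
  "F_obj f lam \<beta> = (\<lambda>(X, Y, S).
     f (X ** transpose Y, S) + lam * (real (nnzc X) + real (nnzc Y)) + \<beta> * real (l0_norm S))"

definition capped :: "(real \<Rightarrow> real) \<Rightarrow> real \<Rightarrow> real" where
  "capped \<theta>1 t = min (\<theta>1 t) 1"

definition Theta_col :: "(real \<Rightarrow> real) \<Rightarrow> real \<Rightarrow> real ^ 'd ^ 'm \<Rightarrow> real" where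
  "Theta_col \<theta> \<rho> V = (\<Sum>i\<in>UNIV. \<theta> (norm (column i V) / \<rho>))"

definition Theta_entry :: "(real \<Rightarrow> real) \<Rightarrow> real \<Rightarrow> real ^ 'n ^ 'm \<Rightarrow> real" where
  "Theta_entry \<theta> \<rho> S = (\<Sum>i\<in>UNIV. \<Sum>j\<in>UNIV. \<theta> (\<bar>S $ i $ j\<bar> / \<rho>))"

definition F_relax ::
    "((real ^ 'n ^ 'm) \<times> (real ^ 'n ^ 'm) \<Rightarrow> real) \<Rightarrow> real \<Rightarrow> real
      \<Rightarrow> (real \<Rightarrow> real) \<Rightarrow> real \<Rightarrow> real
      \<Rightarrow> ('m::finite, 'n::finite, 'd::finite) triple \<Rightarrow> real" where
  "F_relax f lam \<beta> \<theta> r s = (\<lambda>(X, Y, S).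
     f (X ** transpose Y, S) + lam * (Theta_col \<theta> r X + Theta_col \<theta> r Y) + \<beta> * Theta_entry \<theta> s S)"

definition col_index_set :: "real \<Rightarrow> real ^ 'd ^ 'm \<Rightarrow> 'd set" where
  "col_index_set lam U = (if lam > 0 then {i. column i U \<noteq> 0} else UNIV)"

definition consistency :: "real \<Rightarrow> ('m::finite, 'n::finite, 'd::finite) triple \<Rightarrow> bool" where
  "consistency lam = (\<lambda>(X, Y, S). col_index_set lam X = col_index_set lam Y)"

definition isolation ::
    "real \<Rightarrow> real \<Rightarrow> real \<Rightarrow> real \<Rightarrow> ('m::finite, 'n::finite, 'd::finite) triple \<Rightarrow> bool" where
  "isolation lam \<beta> r s = (\<lambda>(X, Y, S).
     (lam > 0 \<longrightarrow> (\<forall>i. norm (column i X) \<notin> {0<..<r} \<and> norm (column i Y) \<notin> {0<..<r})) \<and>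
     (\<beta> > 0 \<longrightarrow> (\<forall>i j. \<bar>S $ i $ j\<bar> \<notin> {0<..<s})))"

definition set_column :: "'d \<Rightarrow> real ^ 'm \<Rightarrow> real ^ 'd ^ 'm \<Rightarrow> real ^ 'd ^ 'm" where
  "set_column k x U = (\<chi> i j. if j = k then x $ i else U $ i $ j)"

definition set_entry :: "'m \<Rightarrow> 'n \<Rightarrow> real \<Rightarrow> real ^ 'n ^ 'm \<Rightarrow> real ^ 'n ^ 'm" where
  "set_entry k l x S = (\<chi> i j. if i = k \<and> j = l then x else S $ i $ j)"

text \<open>Blockwise Lipschitz continuity of \<open>f (X Y\<^sup>T, S)\<close> on \<open>B\<close>: one column (or one entry) varies
  with the triple staying in \<open>B\<close>, and a single constant serves all values of the remaining
  variables and all column and entry indices.\<close>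

definition lipschitz_in_X_columns ::
    "((real ^ 'n ^ 'm) \<times> (real ^ 'n ^ 'm) \<Rightarrow> real)
      \<Rightarrow> ('m::finite, 'n::finite, 'd::finite) triple set \<Rightarrow> real \<Rightarrow> bool" where
  "lipschitz_in_X_columns f B L \<longleftrightarrow>
     (\<forall>(X, Y, S)\<in>B. \<forall>k. L-lipschitz_on {x. (set_column k x X, Y, S) \<in> B}
        (\<lambda>x. f (set_column k x X ** transpose Y, S)))"

definition lipschitz_in_Y_columns ::
    "((real ^ 'n ^ 'm) \<times> (real ^ 'n ^ 'm) \<Rightarrow> real)
      \<Rightarrow> ('m::finite, 'n::finite, 'd::finite) triple set \<Rightarrow> real \<Rightarrow> bool" where
  "lipschitz_in_Y_columns f B L \<longleftrightarrow>
     (\<forall>(X, Y, S)\<in>B. \<forall>k. L-lipschitz_on {y. (X, set_column k y Y, S) \<in> B}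
        (\<lambda>y. f (X ** transpose (set_column k y Y), S)))"

definition lipschitz_in_S_entries ::
    "((real ^ 'n ^ 'm) \<times> (real ^ 'n ^ 'm) \<Rightarrow> real)
      \<Rightarrow> ('m::finite, 'n::finite, 'd::finite) triple set \<Rightarrow> real \<Rightarrow> bool" where
  "lipschitz_in_S_entries f B L \<longleftrightarrow>
     (\<forall>(X, Y, S)\<in>B. \<forall>i j. L-lipschitz_on {x. (X, Y, set_entry i j x S) \<in> B}
        (\<lambda>x. f (X ** transpose Y, set_entry i j x S)))"

definition is_minimum :: "real set \<Rightarrow> real \<Rightarrow> bool" where
  "is_minimum A \<eta> \<longleftrightarrow> \<eta> \<in> A \<and> (\<forall>a\<in>A. \<eta> \<le> a)"

end

theory Submission
  imports Defs
begin

text \<open>A small nonzero column or entry can be replaced by zero: the change of \<open>f\<close> is at most the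
  Lipschitz constant times its size \<open>x\<close>, while Lebourg's mean value theorem gives
  \<open>\<theta>1 t \<ge> \<eta> t\<close> on \<open>[0, 1]\<close>, so the penalty drops by at least \<open>lam \<eta> x / r\<close>, which is more.
  Iterating, every feasible point is dominated in the relaxed problem by a feasible point with the
  isolation property, where both objectives agree; and the relaxed objective never exceeds the
  original one. Minimizers need not exist for this comparison. Consistency holds because a nonzero
  column of one factor facing a zero column of the other does not enter the product.\<close>

section \<open>Lebourg's mean value theorem on the line\<close>

lemma locally_lipschitz_on_imp_continuous_on:
  fixes f :: "'a::metric_space \<Rightarrow> 'b::metric_space"
  assumes "locally_lipschitz_on A f"
  shows "continuous_on A f"
  unfolding continuous_on_eq_continuous_within
proof
  fix x assume "x \<in> A"
  then obtain u L where "u > 0" and lip: "L-lipschitz_on (ball x u \<inter> A) f"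
    using assms unfolding locally_lipschitz_on_def by blast
  then have "continuous (at x within (ball x u \<inter> A)) f"
    using lipschitz_on_continuous_on[OF lip] \<open>x \<in> A\<close>
    by (auto simp: continuous_on_eq_continuous_within)
  \<comment> \<open>The ball is a neighbourhood of \<open>x\<close>, so cutting \<open>A\<close>
    down to it leaves the filter at \<open>x\<close> unchanged.\<close>
  moreover have "at x within (ball x u \<inter> A) = at x within A"
    using \<open>u > 0\<close> by (intro at_within_nhd[of _ "ball x u"]) auto
  ultimately show "continuous (at x within A) f"
    by (simp add: continuous_within)
qed

text \<open>A limsup over the product filter dominates the values along any single curve
  \<open>h \<mapsto> (p h, h)\<close>. The base point may move with \<open>h\<close>, which the
  maximum case of the mean value theorem exploits.\<close>

lemma clarke_dd_ge_along:
  fixes f :: "'a::real_normed_vector \<Rightarrow> real"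
  assumes "filterlim p (nhds x) (at_right (0::real))"
    and "eventually (\<lambda>h. c \<le> (f (p h + h *\<^sub>R v) - f (p h)) / h) (at_right 0)"
  shows "ereal c \<le> clarke_dd f x v"
proof -
  let ?G = "\<lambda>(y, t). ereal ((f (y + t *\<^sub>R v) - f y) / t)"
  have "filterlim (\<lambda>h. (p h, h)) (nhds x \<times>\<^sub>F at_right 0) (at_right 0)"
    using assms(1) by (intro filterlim_Pair filterlim_ident)
  then have le: "filtermap (\<lambda>h. (p h, h)) (at_right 0) \<le> nhds x \<times>\<^sub>F at_right 0"
    by (simp add: filterlim_def)
  have "ereal c \<le> Liminf (at_right 0) (\<lambda>h. ?G (p h, h))"
    using assms(2) by (intro Liminf_bounded) simp
  also have "\<dots> \<le> Limsup (at_right 0) (\<lambda>h. ?G (p h, h))"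
    by (intro Liminf_le_Limsup) simp
  also have "\<dots> \<le> Limsup (filtermap (\<lambda>h. (p h, h)) (at_right 0)) ?G"
    by (rule Limsup_filtermap_ge)
  also have "\<dots> \<le> Limsup (nhds x \<times>\<^sub>F at_right 0) ?G"
    using le unfolding Limsup_def by (intro INF_superset_mono) (auto simp: le_filter_def)
  finally show ?thesis by (simp add: clarke_dd_def)
qed

text \<open>Rolle's argument: subtract the chord, of slope \<open>c\<close>, and find an interior
  extremum of the remainder \<open>g\<close>.\<close>

lemma clarke_subdiff_mean_value:
  fixes f :: "real \<Rightarrow> real"
  assumes "a < b" and cont: "continuous_on {a..b} f"
  shows "\<exists>t\<in>{a<..<b}. (f b - f a) / (b - a) \<in> clarke_subdiff f t"
proof -
  define c where "c = (f b - f a) / (b - a)"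
  define g where "g x = f x - c * x" for x
  have gab: "g a = g b"
    using \<open>a < b\<close> by (simp add: g_def c_def field_simps)
  have quot: "(f (y + h *\<^sub>R v) - f y) / h = c * v + (g (y + h * v) - g y) / h" if "0 < h" for y h v
    using that by (simp add: g_def field_simps)
  have lim0: "((\<lambda>h. t - h * v) \<longlongrightarrow> t) (at_right 0)" "((\<lambda>h. t + h * v) \<longlongrightarrow> t) (at_right 0)"
    for t v :: real
    by (auto intro!: tendsto_eq_intros)
  have near: "eventually (\<lambda>h. t - h * v \<in> {a<..<b}) (at_right 0)"
    "eventually (\<lambda>h. t + h * v \<in> {a<..<b}) (at_right 0)"
    if "t \<in> {a<..<b}" for t v
    by (rule topological_tendstoD[OF lim0(1) open_greaterThanLessThan that],
        rule topological_tendstoD[OF lim0(2) open_greaterThanLessThan that])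
  have pos: "eventually (\<lambda>h::real. 0 < h) (at_right 0)"
    by (simp add: eventually_at_right_less)
  \<comment> \<open>The base point \<open>t - h * v\<close> is chosen so that the step lands on
    \<open>t\<close>: the quotient of \<open>g\<close> is then
    \<open>(g t - g (t - h * v)) / h\<close>, nonnegative for either sign of
    \<open>v\<close>.\<close>
  have at_max: "c \<in> clarke_subdiff f t"
    if t: "t \<in> {a<..<b}" and max: "\<And>x. x \<in> {a<..<b} \<Longrightarrow> g x \<le> g t" for t
    unfolding clarke_subdiff_def mem_Collect_eq
  proof
    fix v :: real
    have "eventually (\<lambda>h. c * v \<le> (f ((t - h * v) + h *\<^sub>R v) - f (t - h * v)) / h) (at_right 0)"
      using near(1)[OF t, of v] pos
      by eventually_elim (simp add: quot max del: real_scaleR_def)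
    from clarke_dd_ge_along[OF lim0(1) this] show "ereal (c \<bullet> v) \<le> clarke_dd f t v"
      by simp
  qed
  \<comment> \<open>Here the step starts at the lowest value, so the constant base point
    \<open>t\<close> already gives a nonnegative quotient of \<open>g\<close>.\<close>
  have at_min: "c \<in> clarke_subdiff f t"
    if t: "t \<in> {a<..<b}" and min: "\<And>x. x \<in> {a<..<b} \<Longrightarrow> g t \<le> g x" for t
    unfolding clarke_subdiff_def mem_Collect_eq
  proof
    fix v :: real
    have "eventually (\<lambda>h. c * v \<le> (f (t + h *\<^sub>R v) - f t) / h) (at_right 0)"
      using near(2)[OF t, of v] pos
      by eventually_elim (simp add: quot min del: real_scaleR_def)
    from clarke_dd_ge_along[OF tendsto_const this] show "ereal (c \<bullet> v) \<le> clarke_dd f t v"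
      by simp
  qed
  have cont_g: "continuous_on {a..b} g"
    unfolding g_def using cont by (intro continuous_intros)
  have ne: "{a..b} \<noteq> {}"
    using \<open>a < b\<close> by simp
  obtain p where p: "p \<in> {a..b}" "\<And>x. x \<in> {a..b} \<Longrightarrow> g x \<le> g p"
    using continuous_attains_sup[OF compact_Icc ne cont_g] by blast
  obtain q where q: "q \<in> {a..b}" "\<And>x. x \<in> {a..b} \<Longrightarrow> g q \<le> g x"
    using continuous_attains_inf[OF compact_Icc ne cont_g] by blast
  have "\<exists>t\<in>{a<..<b}. c \<in> clarke_subdiff f t"
  proof -
    consider "p \<in> {a<..<b}" | "q \<in> {a<..<b}" | "p \<in> {a, b}" "q \<in> {a, b}"
      using p(1) q(1) by fastforce
    then show ?thesis
    proof cases
      case 1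
      then show ?thesis using at_max[of p] p(2) by auto
    next
      case 2
      then show ?thesis using at_min[of q] q(2) by auto
    next
      \<comment> \<open>Both extrema sit at endpoints, where \<open>g\<close> agrees, so
        \<open>g\<close> is constant and the midpoint counts as a maximum.\<close>
      case 3
      then have "g p = g q" using gab by auto
      then have const: "g x = g p" if "x \<in> {a..b}" for x
        using p(2)[OF that] q(2)[OF that] by simp
      have mid: "(a + b) / 2 \<in> {a<..<b}" using \<open>a < b\<close> by auto
      have "c \<in> clarke_subdiff f ((a + b) / 2)"
      proof (rule at_max[OF mid])
        fix x assume "x \<in> {a<..<b}"
        then show "g x \<le> g ((a + b) / 2)"
          using const[of x] const[of "(a + b) / 2"] mid by auto
      qed
      with mid show ?thesis by blast
    qed
  qed
  then show ?thesis by (simp add: c_def)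
qed

text \<open>The mean value theorem on \<open>[0, t]\<close> makes \<open>f t / t\<close> a Clarke
  subgradient at some \<open>u\<close> strictly below \<open>t\<close>, hence \<open>u < 1\<close>
  even when \<open>t = 1\<close>.\<close>

lemma ge_linear_if_clarke_subdiff_ge:
  fixes f :: "real \<Rightarrow> real"
  assumes "continuous_on {0..} f" and "f 0 = 0"
    and ge: "\<And>t \<xi>. 0 < t \<Longrightarrow> t < 1 \<Longrightarrow> \<xi> \<in> clarke_subdiff f t \<Longrightarrow> \<eta> \<le> \<xi>"
    and t: "0 \<le> t" "t \<le> 1"
  shows "\<eta> * t \<le> f t"
proof (cases "t = 0")
  case False
  then have "0 < t" using t by simp
  obtain u where u: "u \<in> {0<..<t}" "(f t - f 0) / (t - 0) \<in> clarke_subdiff f u"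
    using clarke_subdiff_mean_value[OF \<open>0 < t\<close>, of f] continuous_on_subset[OF assms(1), of "{0..t}"]
    by auto
  then have "\<eta> \<le> (f t - f 0) / (t - 0)"
    using t by (intro ge[of u]) auto
  then show ?thesis
    using \<open>0 < t\<close> \<open>f 0 = 0\<close> by (simp add: field_simps)
qed (simp add: \<open>f 0 = 0\<close>)

section \<open>Removing a column or an entry\<close>

lemma column_set_column: "column i (set_column k x U) = (if i = k then x else column i U)"
  by (auto simp: column_def set_column_def vec_eq_iff)

lemma set_column_column: "set_column k (column k U) U = U"
  by (auto simp: column_def set_column_def vec_eq_iff)

lemma set_entry_entry: "set_entry k l (S $ k $ l) S = S"
  by (auto simp: set_entry_def vec_eq_iff)

lemma nnzc_set_column_zero:
  fixes U :: "real ^ 'd::finite ^ 'm::finite"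
  assumes "column k U \<noteq> 0"
  shows "nnzc U = Suc (nnzc (set_column k 0 U))"
proof -
  have "{i. column i U \<noteq> 0} = insert k {i. column i (set_column k 0 U) \<noteq> 0}"
    using assms by (auto simp: column_set_column)
  then show ?thesis
    by (simp add: nnzc_def column_set_column)
qed

lemma l0_norm_set_entry_zero:
  fixes S :: "real ^ 'n::finite ^ 'm::finite"
  assumes "S $ k $ l \<noteq> 0"
  shows "l0_norm S = Suc (l0_norm (set_entry k l 0 S))"
proof -
  have "{(i, j). S $ i $ j \<noteq> 0} = insert (k, l) {(i, j). set_entry k l 0 S $ i $ j \<noteq> 0}"
    using assms by (auto simp: set_entry_def)
  then show ?thesis
    by (simp add: l0_norm_def set_entry_def)
qed

text \<open>Since \<open>\<theta> 0 = 0\<close>, zeroing a column removes exactly its own term; the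
  proof restores that term as a sum supported on \<open>k\<close>.\<close>

lemma Theta_col_set_column_zero:
  fixes U :: "real ^ 'd::finite ^ 'm::finite"
  assumes "\<theta> 0 = 0"
  shows "Theta_col \<theta> \<rho> U = Theta_col \<theta> \<rho> (set_column k 0 U) + \<theta> (norm (column k U) / \<rho>)"
proof -
  have "Theta_col \<theta> \<rho> U = (\<Sum>i\<in>UNIV. \<theta> (norm (column i (set_column k 0 U)) / \<rho>)
      + (if i = k then \<theta> (norm (column k U) / \<rho>) else 0))"
    unfolding Theta_col_def using assms by (intro sum.cong) (auto simp: column_set_column)
  then show ?thesis
    by (simp add: Theta_col_def sum.distrib)
qed

lemma Theta_entry_set_entry_zero:
  fixes S :: "real ^ 'n::finite ^ 'm::finite"
  assumes "\<theta> 0 = 0"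
  shows "Theta_entry \<theta> \<rho> S = Theta_entry \<theta> \<rho> (set_entry k l 0 S) + \<theta> (\<bar>S $ k $ l\<bar> / \<rho>)"
proof -
  have "Theta_entry \<theta> \<rho> S = (\<Sum>i\<in>UNIV. \<Sum>j\<in>UNIV. \<theta> (\<bar>set_entry k l 0 S $ i $ j\<bar> / \<rho>)
      + (if i = k then if j = l then \<theta> (\<bar>S $ k $ l\<bar> / \<rho>) else 0 else 0))"
    unfolding Theta_entry_def using assms by (intro sum.cong) (auto simp: set_entry_def)
  also have "\<dots> = Theta_entry \<theta> \<rho> (set_entry k l 0 S)
      + (\<Sum>i\<in>UNIV. if i = k then \<theta> (\<bar>S $ k $ l\<bar> / \<rho>) else 0)"
    unfolding Theta_entry_def sum.distrib
    by (intro arg_cong2[where f="(+)"] refl sum.cong) simp_all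
  finally show ?thesis by simp
qed

section \<open>Penalties against counts\<close>

lemma Theta_col_le_nnzc:
  fixes U :: "real ^ 'd::finite ^ 'm::finite"
  assumes "\<theta> 0 = 0" and "\<And>t. \<theta> t \<le> 1"
  shows "Theta_col \<theta> \<rho> U \<le> real (nnzc U)"
proof -
  have "Theta_col \<theta> \<rho> U \<le> (\<Sum>i\<in>UNIV. if column i U \<noteq> 0 then 1 else 0)"
    unfolding Theta_col_def using assms by (intro sum_mono) auto
  then show ?thesis by (simp add: nnzc_def sum.If_cases)
qed

text \<open>The scaled norms are 0 or at least 1, and at such arguments \<open>\<theta>\<close> is
  the indicator of being nonzero.\<close>

lemma Theta_col_eq_nnzc:
  fixes U :: "real ^ 'd::finite ^ 'm::finite"
  assumes "\<theta> 0 = 0" and "\<And>t. 1 \<le> t \<Longrightarrow> \<theta> t = 1" and "0 < \<rho>"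
    and "\<And>i. norm (column i U) \<notin> {0<..<\<rho>}"
  shows "Theta_col \<theta> \<rho> U = real (nnzc U)"
proof -
  have "Theta_col \<theta> \<rho> U = (\<Sum>i\<in>UNIV. if column i U \<noteq> 0 then 1 else 0)"
    unfolding Theta_col_def
  proof (intro sum.cong refl)
    fix i
    show "\<theta> (norm (column i U) / \<rho>) = (if column i U \<noteq> 0 then 1 else 0)"
      using assms(1,3) assms(4)[of i] by (auto intro!: assms(2) simp: not_less)
  qed
  then show ?thesis by (simp add: nnzc_def sum.If_cases)
qed

text \<open>Brings the count of index pairs into the shape of \<open>Theta_entry\<close>, so that
  the two can be compared entry by entry.\<close>

lemma l0_norm_eq_sum:
  fixes S :: "real ^ 'n::finite ^ 'm::finite"
  shows "real (l0_norm S) = (\<Sum>i\<in>UNIV. \<Sum>j\<in>UNIV. if S $ i $ j \<noteq> 0 then 1 else 0)"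
proof -
  have "(\<Sum>i\<in>UNIV. \<Sum>j\<in>UNIV. if S $ i $ j \<noteq> 0 then 1 else 0)
      = (\<Sum>p\<in>UNIV. if p \<in> {(i, j). S $ i $ j \<noteq> 0} then 1 else (0::real))"
    unfolding sum.cartesian_product UNIV_Times_UNIV by (intro sum.cong) auto
  then show ?thesis
    by (simp add: l0_norm_def sum.If_cases del: mem_Collect_eq case_prod_conv)
qed

lemma Theta_entry_le_l0_norm:
  fixes S :: "real ^ 'n::finite ^ 'm::finite"
  assumes "\<theta> 0 = 0" and "\<And>t. \<theta> t \<le> 1"
  shows "Theta_entry \<theta> \<rho> S \<le> real (l0_norm S)"
  unfolding Theta_entry_def l0_norm_eq_sum using assms by (intro sum_mono) auto

lemma Theta_entry_eq_l0_norm: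
  fixes S :: "real ^ 'n::finite ^ 'm::finite"
  assumes "\<theta> 0 = 0" and "\<And>t. 1 \<le> t \<Longrightarrow> \<theta> t = 1" and "0 < \<rho>"
    and "\<And>i j. \<bar>S $ i $ j\<bar> \<notin> {0<..<\<rho>}"
  shows "Theta_entry \<theta> \<rho> S = real (l0_norm S)"
  unfolding Theta_entry_def l0_norm_eq_sum
proof (intro sum.cong refl)
  fix i j
  show "\<theta> (\<bar>S $ i $ j\<bar> / \<rho>) = (if S $ i $ j \<noteq> 0 then 1 else 0)"
    using assms(1,3) assms(4)[of i j] by (auto intro!: assms(2) simp: not_less)
qed

text \<open>In the product, column \<open>k\<close> of \<open>X\<close> meets only the entries of
  column \<open>k\<close> of \<open>Y\<close>, which vanish.\<close>

lemma set_column_zero_mult_transpose: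
  fixes X :: "real ^ 'd::finite ^ 'm::finite" and Y :: "real ^ 'd ^ 'n::finite"
  assumes "column k Y = 0"
  shows "set_column k 0 X ** transpose Y = X ** transpose Y"
proof -
  have "Y $ j $ k = 0" for j
    using assms by (simp add: column_def vec_eq_iff)
  then have "(\<Sum>l\<in>UNIV. set_column k 0 X $ i $ l * Y $ j $ l) = (\<Sum>l\<in>UNIV. X $ i $ l * Y $ j $ l)"
    for i j
    by (intro sum.cong) (auto simp: set_column_def)
  then show ?thesis
    by (simp add: matrix_matrix_mult_def transpose_def vec_eq_iff)
qed

lemma mult_transpose_set_column_zero:
  fixes X :: "real ^ 'd::finite ^ 'm::finite" and Y :: "real ^ 'd ^ 'n::finite"
  assumes "column k X = 0"
  shows "X ** transpose (set_column k 0 Y) = X ** transpose Y"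
proof -
  \<comment> \<open>Transposing the product exchanges the factors and reduces the claim to the
    previous lemma.\<close>
  have "X ** transpose V = transpose (V ** transpose X)" for V :: "real ^ 'd ^ 'n"
    by (simp add: matrix_transpose_mul)
  then show ?thesis
    using set_column_zero_mult_transpose[OF assms, of Y] by simp
qed

lemma set_column_zero_in_col_ball:
  assumes "U \<in> col_ball \<tau>" and "0 \<le> \<tau>"
  shows "set_column k 0 U \<in> col_ball \<tau>"
  using assms by (auto simp: col_ball_def column_set_column zero_ereal_def)

lemma set_entry_zero_in_entry_box:
  assumes "S \<in> entry_box \<kappa>1 \<kappa>2" and "\<And>i j. \<kappa>1 i j \<le> 0" and "\<And>i j. 0 \<le> \<kappa>2 i j"
  shows "set_entry k l 0 S \<in> entry_box \<kappa>1 \<kappa>2"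
  using assms by (auto simp: entry_box_def set_entry_def zero_ereal_def)

section \<open>Comparison of the two problems\<close>

text \<open>Balances the effects of zeroing a block of size \<open>x\<close>: \<open>L * x\<close>
  bounds the increase of \<open>f\<close>, and \<open>c * \<theta> (x / \<rho>)\<close> is the
  penalty saved. The parameter condition compares the slopes \<open>L\<close> and
  \<open>c * \<eta> / \<rho>\<close>.\<close>

lemma penalty_gain:
  fixes L x \<rho> c \<eta> :: real
  assumes "\<And>t. 0 \<le> t \<Longrightarrow> t \<le> 1 \<Longrightarrow> \<eta> * t \<le> \<theta> t"
    and "0 < c" "\<rho> * L < c * \<eta>" "x \<in> {0<..<\<rho>}"
  shows "L * x < c * \<theta> (x / \<rho>)"
proof -
  have "0 < x" "x < \<rho>" using assms(4) by auto
  then have "L * x < c * (\<eta> * (x / \<rho>))"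
    using assms(3) by (simp add: field_simps)
  also have "\<dots> \<le> c * \<theta> (x / \<rho>)"
    using assms(1)[of "x / \<rho>"] \<open>0 < c\<close> \<open>0 < x\<close> \<open>x < \<rho>\<close> by (intro mult_left_mono) auto
  finally show ?thesis .
qed

theorem theorem2:
  fixes f :: "(real ^ 'n::finite ^ 'm::finite) \<times> (real ^ 'n ^ 'm) \<Rightarrow> real"
    and lam \<beta> r s \<eta> L\<^sub>X L\<^sub>Y L\<^sub>S :: real
    and \<tau> :: ereal
    and \<kappa>1 \<kappa>2 :: "'m \<Rightarrow> 'n \<Rightarrow> ereal"
    and \<theta>1 \<theta> :: "real \<Rightarrow> real"
    and B :: "('m, 'n, 'd::finite) triple set"
  assumes "0 \<le> lam" and "0 \<le> \<beta>" and "0 \<le> \<tau>"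
    and "\<And>i j. \<kappa>1 i j \<le> 0" and "\<And>i j. 0 \<le> \<kappa>2 i j"
    and B: "B = feasible_set \<tau> \<kappa>1 \<kappa>2"
    and "\<And>Z. 0 \<le> f Z" and "locally_lipschitz_on UNIV f"
    and "\<And>t. 0 \<le> t \<Longrightarrow> 0 \<le> \<theta>1 t"
    and "\<theta>1 0 = 0" and "\<theta>1 1 = 1"
    and "\<And>t. 0 < t \<Longrightarrow> t < 1 \<Longrightarrow> 0 < \<theta>1 t \<and> \<theta>1 t < 1"
    and "\<And>t. 1 < t \<Longrightarrow> 1 < \<theta>1 t"
    and \<theta>: "\<theta> = capped \<theta>1"
    and "0 < r" and "0 < s"
    and A_i_XY: "0 < lam \<Longrightarrow>
      0 < L\<^sub>X \<and> lipschitz_in_X_columns f B L\<^sub>X \<and> 0 < L\<^sub>Y \<and> lipschitz_in_Y_columns f B L\<^sub>Y"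
    and A_i_S: "0 < \<beta> \<Longrightarrow> 0 < L\<^sub>S \<and> lipschitz_in_S_entries f B L\<^sub>S"
    and A_ii_lip: "locally_lipschitz_on {0..} \<theta>1"
    and A_ii_eta: "is_minimum (\<Union>t\<in>{0<..<1}. clarke_subdiff \<theta>1 t) \<eta>" "0 < \<eta>"
    and A_ii_r: "0 < lam \<Longrightarrow> ereal r < min \<tau> (ereal (lam * \<eta> / max L\<^sub>X L\<^sub>Y))"
    and A_ii_s: "0 < \<beta> \<Longrightarrow> s < \<beta> * \<eta> / L\<^sub>S"
  shows "(\<forall>z \<in> global_minimizers (F_relax f lam \<beta> \<theta> r s) B. isolation lam \<beta> r s z) \<and>
    global_minimizers (F_obj f lam \<beta>) B = global_minimizers (F_relax f lam \<beta> \<theta> r s) B \<and>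
    optimal_value (F_obj f lam \<beta>) B = optimal_value (F_relax f lam \<beta> \<theta> r s) B \<and>
    (\<forall>z \<in> global_minimizers (F_obj f lam \<beta>) B \<union> global_minimizers (F_relax f lam \<beta> \<theta> r s) B.
       consistency lam z \<and> isolation lam \<beta> r s z)"
proof -

  \<comment> \<open>Bounds on the penalty function and the parameters\<close>
  note capped_def [simp]
  have \<theta>0: "\<theta> 0 = 0" and \<theta>_le: "\<And>t. \<theta> t \<le> 1"
    using \<open>\<theta>1 0 = 0\<close> by (auto simp: \<theta>)
  have \<theta>_one: "\<theta> t = 1" if "1 \<le> t" for t
    using that \<open>\<theta>1 1 = 1\<close> \<open>\<And>t. 1 < t \<Longrightarrow> 1 < \<theta>1 t\<close>[of t] by (cases "t = 1") (auto simp: \<theta>)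
  have \<theta>1_ge: "\<eta> * t \<le> \<theta>1 t" if "0 \<le> t" "t \<le> 1" for t
    using A_ii_eta(1) that
    by (intro ge_linear_if_clarke_subdiff_ge locally_lipschitz_on_imp_continuous_on[OF A_ii_lip])
      (auto simp: is_minimum_def \<open>\<theta>1 0 = 0\<close>)
  \<comment> \<open>Capping preserves the linear bound, because
    \<open>\<eta> \<le> \<theta>1 1 = 1\<close> gives \<open>\<eta> * t \<le> 1\<close>.\<close>
  have \<theta>_ge: "\<eta> * t \<le> \<theta> t" if "0 \<le> t" "t \<le> 1" for t
  proof -
    have "\<eta> * t \<le> \<eta> * 1" using that A_ii_eta(2) by (intro mult_left_mono) auto
    also have "\<eta> * 1 \<le> 1" using \<theta>1_ge[of 1] \<open>\<theta>1 1 = 1\<close> by simp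
    finally show ?thesis using \<theta>1_ge[OF that] by (simp add: \<theta>)
  qed
  have rL: "r * L\<^sub>X < lam * \<eta>" "r * L\<^sub>Y < lam * \<eta>" if "0 < lam"
  proof -
    have "0 < max L\<^sub>X L\<^sub>Y" using A_i_XY[OF that] by auto
    moreover have "r < lam * \<eta> / max L\<^sub>X L\<^sub>Y" using A_ii_r[OF that] by simp
    ultimately have "r * max L\<^sub>X L\<^sub>Y < lam * \<eta>" by (simp add: pos_less_divide_eq)
    moreover have "r * L\<^sub>X \<le> r * max L\<^sub>X L\<^sub>Y" "r * L\<^sub>Y \<le> r * max L\<^sub>X L\<^sub>Y"
      using \<open>0 < r\<close> by (auto intro!: mult_left_mono)
    ultimately show "r * L\<^sub>X < lam * \<eta>" "r * L\<^sub>Y < lam * \<eta>" by linarith+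
  qed
  have sL: "s * L\<^sub>S < \<beta> * \<eta>" if "0 < \<beta>"
    using A_ii_s[OF that] A_i_S[OF that] by (simp add: pos_less_divide_eq)
  \<comment> \<open>Zero is admissible in every block: \<open>\<tau>\<close> is nonnegative and each
    interval from \<open>\<kappa>1\<close> to \<open>\<kappa>2\<close> contains 0.\<close>
  have feas_X: "(set_column k 0 X, Y, S) \<in> B"
    and feas_Y: "(X, set_column k 0 Y, S) \<in> B"
    and feas_S: "(X, Y, set_entry i j 0 S) \<in> B"
    if "(X, Y, S) \<in> B" for X Y S k i j
    using that assms(3-5)
    by (auto simp: B feasible_set_def intro: set_column_zero_in_col_ball set_entry_zero_in_entry_box)

  \<comment> \<open>Descent in the relaxed problem\<close>
  let ?F = "F_obj f lam \<beta>" and ?R = "F_relax f lam \<beta> \<theta> r s"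
  let ?size = "\<lambda>(X, Y, S). nnzc X + nnzc Y + l0_norm S"

  have step: "\<exists>z'\<in>B. ?R z' < ?R z \<and> ?size z' < ?size z"
    if zB: "z \<in> B" and bad: "\<not> isolation lam \<beta> r s z" for z
  proof -
    obtain X Y S where z: "z = (X, Y, S)" by (cases z)
    have mem: "(X, Y, S) \<in> B" using zB z by simp
    \<comment> \<open>Isolation can fail only where the weight is positive, so the Lipschitz
      constant of that block is available.\<close>
    consider (X) k where "0 < lam" "norm (column k X) \<in> {0<..<r}"
      | (Y) k where "0 < lam" "norm (column k Y) \<in> {0<..<r}"
      | (S) i j where "0 < \<beta>" "\<bar>S $ i $ j\<bar> \<in> {0<..<s}"
      using bad unfolding z isolation_def by auto
    then show ?thesis
    proof cases
      case X
      have "L\<^sub>X-lipschitz_on {x. (set_column k x X, Y, S) \<in> B}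
          (\<lambda>x. f (set_column k x X ** transpose Y, S))"
        using A_i_XY[OF X(1)] mem unfolding lipschitz_in_X_columns_def by blast
      \<comment> \<open>Both points lie in the Lipschitz domain: zero by \<open>feas_X\<close>, the
        current column because reinserting it gives back \<open>X\<close>.\<close>
      from lipschitz_onD[OF this, of 0 "column k X"]
      have "f (set_column k 0 X ** transpose Y, S)
          \<le> f (X ** transpose Y, S) + L\<^sub>X * norm (column k X)"
        using mem feas_X[OF mem] by (simp add: set_column_column dist_real_def)
      moreover have "L\<^sub>X * norm (column k X) < lam * \<theta> (norm (column k X) / r)"
        using penalty_gain[where \<theta>=\<theta>, OF \<theta>_ge X(1) rL(1)[OF X(1)] X(2)] by simp
      moreover have "lam * Theta_col \<theta> r X
          = lam * Theta_col \<theta> r (set_column k 0 X) + lam * \<theta> (norm (column k X) / r)"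
        by (subst Theta_col_set_column_zero[where \<theta>=\<theta> and k=k, OF \<theta>0]) (simp add: distrib_left)
      ultimately have "?R (set_column k 0 X, Y, S) < ?R z"
        by (simp add: z F_relax_def distrib_left)
      moreover have "?size (set_column k 0 X, Y, S) < ?size z"
        using X(2) nnzc_set_column_zero[of k X] by (auto simp: z)
      ultimately show ?thesis using feas_X[OF mem] by blast
    next
      case Y
      have "L\<^sub>Y-lipschitz_on {y. (X, set_column k y Y, S) \<in> B}
          (\<lambda>y. f (X ** transpose (set_column k y Y), S))"
        using A_i_XY[OF Y(1)] mem unfolding lipschitz_in_Y_columns_def by blast
      from lipschitz_onD[OF this, of 0 "column k Y"]
      have "f (X ** transpose (set_column k 0 Y), S)
          \<le> f (X ** transpose Y, S) + L\<^sub>Y * norm (column k Y)"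
        using mem feas_Y[OF mem] by (simp add: set_column_column dist_real_def)
      moreover have "L\<^sub>Y * norm (column k Y) < lam * \<theta> (norm (column k Y) / r)"
        using penalty_gain[where \<theta>=\<theta>, OF \<theta>_ge Y(1) rL(2)[OF Y(1)] Y(2)] by simp
      moreover have "lam * Theta_col \<theta> r Y
          = lam * Theta_col \<theta> r (set_column k 0 Y) + lam * \<theta> (norm (column k Y) / r)"
        by (subst Theta_col_set_column_zero[where \<theta>=\<theta> and k=k, OF \<theta>0]) (simp add: distrib_left)
      ultimately have "?R (X, set_column k 0 Y, S) < ?R z"
        by (simp add: z F_relax_def distrib_left)
      moreover have "?size (X, set_column k 0 Y, S) < ?size z"
        using Y(2) nnzc_set_column_zero[of k Y] by (auto simp: z)
      ultimately show ?thesis using feas_Y[OF mem] by blast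
    next
      case S
      have "L\<^sub>S-lipschitz_on {x. (X, Y, set_entry i j x S) \<in> B}
          (\<lambda>x. f (X ** transpose Y, set_entry i j x S))"
        using A_i_S[OF S(1)] mem unfolding lipschitz_in_S_entries_def by blast
      from lipschitz_onD[OF this, of 0 "S $ i $ j"]
      have "f (X ** transpose Y, set_entry i j 0 S)
          \<le> f (X ** transpose Y, S) + L\<^sub>S * \<bar>S $ i $ j\<bar>"
        using mem feas_S[OF mem] by (simp add: set_entry_entry dist_real_def)
      moreover have "L\<^sub>S * \<bar>S $ i $ j\<bar> < \<beta> * \<theta> (\<bar>S $ i $ j\<bar> / s)"
        using penalty_gain[where \<theta>=\<theta>, OF \<theta>_ge S(1) sL[OF S(1)] S(2)] by simp
      moreover have "\<beta> * Theta_entry \<theta> s S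
          = \<beta> * Theta_entry \<theta> s (set_entry i j 0 S) + \<beta> * \<theta> (\<bar>S $ i $ j\<bar> / s)"
        by (subst Theta_entry_set_entry_zero[where \<theta>=\<theta> and k=i and l=j, OF \<theta>0]) (simp add: distrib_left)
      ultimately have "?R (X, Y, set_entry i j 0 S) < ?R z"
        by (simp add: z F_relax_def)
      moreover have "?size (X, Y, set_entry i j 0 S) < ?size z"
        using S(2) l0_norm_set_entry_zero[of S i j] by (auto simp: z)
      ultimately show ?thesis using feas_S[OF mem] by blast
    qed
  qed
  \<comment> \<open>Strict decrease of a real value alone would not end the iteration; the natural
    number \<open>?size\<close> does.\<close>
  have reduce: "\<exists>z'\<in>B. isolation lam \<beta> r s z' \<and> ?R z' \<le> ?R z" if "z \<in> B" for z
    using that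
  proof (induction z rule: measure_induct_rule[of ?size])
    case (less z)
    show ?case
    proof (cases "isolation lam \<beta> r s z")
      case True
      then show ?thesis using less.prems by auto
    next
      case False
      then obtain w where "w \<in> B" "?R w < ?R z" "?size w < ?size z"
        using step[OF less.prems] by blast
      then show ?thesis using less.IH[of w] by (meson less_imp_le order_trans)
    qed
  qed

  \<comment> \<open>Relations between the two objectives\<close>
  have R_le_F: "?R z \<le> ?F z" for z
  proof -
    obtain X Y S where z: "z = (X, Y, S)" by (cases z)
    have "lam * (Theta_col \<theta> r X + Theta_col \<theta> r Y) \<le> lam * (real (nnzc X) + real (nnzc Y))"
      using \<open>0 \<le> lam\<close> by (intro mult_left_mono add_mono Theta_col_le_nnzc \<theta>0 \<theta>_le)
    moreover have "\<beta> * Theta_entry \<theta> s S \<le> \<beta> * real (l0_norm S)"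
      using \<open>0 \<le> \<beta>\<close> by (intro mult_left_mono Theta_entry_le_l0_norm \<theta>0 \<theta>_le)
    ultimately show ?thesis by (simp add: z F_relax_def F_obj_def)
  qed
  have R_eq_F: "?R z = ?F z" if iso: "isolation lam \<beta> r s z" for z
  proof -
    obtain X Y S where z: "z = (X, Y, S)" by (cases z)
    have "lam * (Theta_col \<theta> r X + Theta_col \<theta> r Y) = lam * (real (nnzc X) + real (nnzc Y))"
    \<comment> \<open>For weight zero isolation says nothing about the columns, but then both
      penalty terms vanish.\<close>
    proof (cases "lam = 0")
      case False
      then have "\<forall>i. norm (column i X) \<notin> {0<..<r} \<and> norm (column i Y) \<notin> {0<..<r}"
        using iso \<open>0 \<le> lam\<close> by (auto simp: z isolation_def)
      then show ?thesis
        using Theta_col_eq_nnzc[where \<theta>=\<theta> and U=X, OF \<theta>0 \<theta>_one \<open>0 < r\<close>]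
          Theta_col_eq_nnzc[where \<theta>=\<theta> and U=Y, OF \<theta>0 \<theta>_one \<open>0 < r\<close>] by metis
    qed simp
    moreover have "\<beta> * Theta_entry \<theta> s S = \<beta> * real (l0_norm S)"
    proof (cases "\<beta> = 0")
      case False
      then have "\<forall>i j. \<bar>S $ i $ j\<bar> \<notin> {0<..<s}"
        using iso \<open>0 \<le> \<beta>\<close> by (auto simp: z isolation_def)
      then show ?thesis
        using Theta_entry_eq_l0_norm[where \<theta>=\<theta> and S=S, OF \<theta>0 \<theta>_one \<open>0 < s\<close>] by metis
    qed simp
    ultimately show ?thesis by (simp only: z F_relax_def F_obj_def prod.case)
  qed

  \<comment> \<open>Minimizers and optimal values\<close>
  have iso: "isolation lam \<beta> r s z" if "z \<in> global_minimizers ?R B" for z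
    using that step[of z] by (fastforce simp: global_minimizers_def)
  have dominated: "\<exists>z'\<in>B. ?F z' \<le> ?R z" if "z \<in> B" for z
    using reduce[OF that] R_eq_F by metis
  have min_eq: "global_minimizers ?F B = global_minimizers ?R B"
  proof (intro equalityI subsetI)
    fix z assume z: "z \<in> global_minimizers ?F B"
    \<comment> \<open>The chain is \<open>?R z \<le> ?F z \<le> ?F w' \<le> ?R w\<close>, with
      \<open>w'\<close> an original-problem competitor dominating \<open>w\<close>.\<close>
    have "?R z \<le> ?R w" if "w \<in> B" for w
    proof -
      obtain w' where "w' \<in> B" "?F w' \<le> ?R w" using dominated[OF \<open>w \<in> B\<close>] by blast
      moreover have "?F z \<le> ?F w'" using z \<open>w' \<in> B\<close> by (simp add: global_minimizers_def)
      ultimately show ?thesis using R_le_F[of z] by linarith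
    qed
    then show "z \<in> global_minimizers ?R B"
      using z by (simp add: global_minimizers_def)
  next
    fix z assume z: "z \<in> global_minimizers ?R B"
    \<comment> \<open>Here \<open>?F z = ?R z \<le> ?R w \<le> ?F w\<close>, the equality coming
      from the isolation of relaxed minimizers.\<close>
    show "z \<in> global_minimizers ?F B"
      using z R_eq_F[OF iso[OF z]] R_le_F order_trans by (fastforce simp: global_minimizers_def)
  qed
  have val_eq: "optimal_value ?F B = optimal_value ?R B"
    unfolding optimal_value_def
  \<comment> \<open>Every value of either objective is matched by one of the other that is no
    larger, so the infima agree whether or not they are attained.\<close>
  proof (intro antisym INF_mono)
    fix z assume "z \<in> B"
    then show "\<exists>w\<in>B. ereal (?F w) \<le> ereal (?R z)"
      using dominated[of z] by simp
    show "\<exists>w\<in>B. ereal (?R w) \<le> ereal (?F z)"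
      using \<open>z \<in> B\<close> R_le_F[of z] by (intro bexI[of _ z]) simp_all
  qed
  have cons: "consistency lam z" if z_min: "z \<in> global_minimizers ?F B" for z
  proof (rule ccontr)
    assume neg: "\<not> consistency lam z"
    obtain X Y S where z: "z = (X, Y, S)" by (cases z)
    have mem: "(X, Y, S) \<in> B" and opt: "\<And>w. w \<in> B \<Longrightarrow> ?F (X, Y, S) \<le> ?F w"
      using z_min by (auto simp: z global_minimizers_def)
    \<comment> \<open>Without a positive \<open>lam\<close> both index sets are \<open>UNIV\<close>,
      so a violation forces \<open>0 < lam\<close> and a column that is nonzero in exactly one
      factor.\<close>
    from neg obtain k where "0 < lam"
      and k: "(column k X \<noteq> 0 \<and> column k Y = 0) \<or> (column k X = 0 \<and> column k Y \<noteq> 0)"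
      by (auto simp: z consistency_def col_index_set_def split: if_splits)
    from k show False
    proof (elim disjE conjE)
      assume "column k X \<noteq> 0" "column k Y = 0"
      \<comment> \<open>The product, and with it \<open>f\<close>, is unchanged while one count
        falls by 1, so \<open>?F\<close> drops by exactly \<open>lam\<close>.\<close>
      then have "?F (set_column k 0 X, Y, S) < ?F (X, Y, S)"
        using \<open>0 < lam\<close> by (simp add: F_obj_def set_column_zero_mult_transpose nnzc_set_column_zero)
      then show False using opt[OF feas_X[OF mem, of k]] by simp
    next
      assume "column k X = 0" "column k Y \<noteq> 0"
      then have "?F (X, set_column k 0 Y, S) < ?F (X, Y, S)"
        using \<open>0 < lam\<close> by (simp add: F_obj_def mult_transpose_set_column_zero nnzc_set_column_zero)
      then show False using opt[OF feas_Y[OF mem, of k]] by simp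
    qed
  qed
  \<comment> \<open>Isolation was shown for relaxed minimizers and consistency for original ones;
    \<open>min_eq\<close> transfers each to the other set.\<close>
  show ?thesis
    using iso min_eq val_eq cons by auto
qed

end
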